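(* Writing $f|_{q^s}$ for the coefficient of $q^s$ in a polynomial $f$: (1) For all $n\ge k\ge1$, $\overline{\mathbf{SF}}_{n,k}(q)|_{q^0}=\binom{n-1}{k-1}$. (2) For all $n>k\ge2$, $\overline{\mathbf{SF}}_{n,k}(q)|_{q}=(k-2)\binom{n-1}{k}$. (3) For all integers $s\ge0$ and $n\ge s$, $\overline{\mathbf{SF}}_{n,3}(q)|_{q^s}=\binom{n-1}{s+2}$. (4) For all $n\ge k\ge3$, $\overline{\mathbf{SF}}_{n,k}(q)|_{q^2}=(k-3)\binom{n-1}{k}+\binom{k-1}{2}\binom{n-1}{k+1}$. (5) For all $n\ge k\ge4$, $\overline{\mathbf{SF}}_{n,k}(q)|_{q^3}=(k-4)\binom{n-1}{k}+\left(\binom{k-1}{2}+\binom{k-2}{2}-1\right)\binom{n-1}{k+1}+\binom{k}{3}\binom{n-1}{k+2}$. (6) For all $n\ge k\ge4$, $$\overline{\mathbf{SF}}_{n,k}(q)|_{q^4}=(k-4)\binom{n-1}{k}+\left(\binom{k-1}{2}+\binom{k-2}{2}+\binom{k-3}{2}-3\right)\binom{n-1}{k+1}+\left(2\binom{k}{3}+\binom{k-1}{3}-k+1\right)\binom{n-1}{k+2}+\binom{k+1}{4}\binom{n-1}{k+3}.$$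
   Context: Fibonacci numbers: $F_0=0$, $F_1=1$, $F_m=F_{m-1}+F_{m-2}$. For any integer $m$, $[m]_q=\frac{1-q^m}{1-q}$. For $k\ge0$ let $\overline{[x]}_{\downarrow_{q,F,k}}=\prod_{i=0}^{k-1}([x]_q-[F_i]_q)$ (empty product $=1$). For $n\ge0$, $\overline{\mathbf{SF}}_{n,k}(q)$ ($0\le k\le n$) are the unique functions of $q$ (they are polynomials in $q$) with $[x]_q^n=\sum_{k=0}^n\overline{\mathbf{SF}}_{n,k}(q)\overline{[x]}_{\downarrow_{q,F,k}}$ for all positive integers $x$; $\overline{\mathbf{SF}}_{n,k}(q)=0$ if $k>n$. Binomial convention: $\binom{m}{j}=0$ whenever $m<j$ (including $m<0$). *)

theory Defs
  imports "HOL-Computational_Algebra.Computational_Algebra" "HOL-Number_Theory.Fib"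
begin

text \<open>
  Functions of \<open>q\<close> are elements of the field of rational functions \<open>\<rat>(q)\<close>, obtained as the
  fraction field of \<open>\<int>[q]\<close>, so that \<open>[m]\<^sub>q\<close> makes sense for every integer \<open>m\<close>.
\<close>

definition qvar :: "int poly fract" where
  "qvar = to_fract [:0, 1:]"

definition qint :: "int \<Rightarrow> int poly fract" where
  "qint m = (1 - qvar powi m) / (1 - qvar)"

definition qfib_falling :: "int \<Rightarrow> nat \<Rightarrow> int poly fract" where
  "qfib_falling x k = (\<Prod>i<k. qint x - qint (int (fib i)))"

definition is_SFbar_row :: "nat \<Rightarrow> (nat \<Rightarrow> int poly fract) \<Rightarrow> bool" where
  "is_SFbar_row n c \<longleftrightarrow>
     (\<forall>k>n. c k = 0) \<and> (\<forall>x>0. qint x ^ n = (\<Sum>k\<le>n. c k * qfib_falling x k))"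

text \<open>The description is proper by \<open>ex1_SFbar_row\<close> below.\<close>

definition SFbar :: "nat \<Rightarrow> nat \<Rightarrow> int poly fract" where
  "SFbar n = (THE c. is_SFbar_row n c)"

text \<open>
  Only meaningful if \<open>f\<close> is a polynomial in \<open>q\<close>; this holds for \<open>SFbar n k\<close> by
  \<open>SFbar_polynomial\<close> below.
\<close>

definition qcoeff :: "int poly fract \<Rightarrow> nat \<Rightarrow> int" where
  "qcoeff f s = coeff (THE p. f = to_fract p) s"

lemma qcoeff_to_fract [simp]: "qcoeff (to_fract p) s = coeff p s"
  by (simp add: qcoeff_def)

lemma to_fract_power: "to_fract (p ^ n) = to_fract p ^ n"
  by (induction n) auto

lemma qvar_neq_1: "qvar \<noteq> 1"
proof -
  have "[:0, 1:] \<noteq> (1 :: int poly)" by (simp add: one_pCons)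
  thus ?thesis unfolding qvar_def by (metis to_fract_1 to_fract_eq_iff)
qed

lemma qint_of_nat: "qint (int m) = to_fract (\<Sum>i<m. [:0, 1:] ^ i)"
proof -
  have "(1 - qvar) * (\<Sum>i<m. qvar ^ i) = 1 - qvar ^ m"
    by (rule one_diff_power_eq [symmetric])
  thus ?thesis using qvar_neq_1
    by (simp add: qint_def to_fract_sum to_fract_power qvar_def [symmetric] field_simps)
qed

lemma inj_qint_of_nat: "inj (\<lambda>m. qint (int m))"
proof (rule injI)
  fix m n :: nat
  assume "qint (int m) = qint (int n)"
  hence "qvar ^ m = qvar ^ n" using qvar_neq_1 by (simp add: qint_def)
  hence "[:0, 1:] ^ m = ([:0, 1:] ^ n :: int poly)"
    by (simp add: qvar_def to_fract_power [symmetric])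
  hence "degree ([:0, 1:] ^ m :: int poly) = degree ([:0, 1:] ^ n :: int poly)" by simp
  thus "m = n" by (simp add: degree_power_eq)
qed

lemma ex_polynomial_SFbar_row: "\<exists>c. is_SFbar_row n (\<lambda>k. to_fract (c k))"
proof (induction n)
  case 0
  show ?case
    by (rule exI [of _ "\<lambda>k. if k = 0 then 1 else 0"])
       (simp add: is_SFbar_row_def qfib_falling_def)
next
  case (Suc n)
  then obtain c where c0: "\<And>k. k > n \<Longrightarrow> c k = 0"
    and c: "\<And>x. x > 0 \<Longrightarrow> qint x ^ n = (\<Sum>k\<le>n. to_fract (c k) * qfib_falling x k)"
    by (auto simp: is_SFbar_row_def)
  define F where "F i = (\<Sum>j<fib i. [:0, 1:] ^ j :: int poly)" for i
  define d where "d k = (case k of 0 \<Rightarrow> 0 | Suc j \<Rightarrow> c j) + F k * c k" for k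
  have "qint x ^ Suc n = (\<Sum>k\<le>Suc n. to_fract (d k) * qfib_falling x k)" if "x > 0" for x
  proof -
    let ?f = "qfib_falling x"
    have step: "qint x * ?f k = ?f (Suc k) + to_fract (F k) * ?f k" for k
      unfolding F_def qint_of_nat [symmetric] by (simp add: qfib_falling_def algebra_simps)
    have "qint x ^ Suc n = (\<Sum>k\<le>n. to_fract (c k) * (qint x * ?f k))"
      using c [OF that] by (simp add: sum_distrib_left mult_ac)
    also have "\<dots> = (\<Sum>k\<le>n. to_fract (c k) * ?f (Suc k)) + (\<Sum>k\<le>n. to_fract (F k * c k) * ?f k)"
      unfolding step by (simp add: sum.distrib algebra_simps)
    also have "(\<Sum>k\<le>n. to_fract (F k * c k) * ?f k) = (\<Sum>k\<le>Suc n. to_fract (F k * c k) * ?f k)"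
      by (simp add: c0)
    also have "(\<Sum>k\<le>n. to_fract (c k) * ?f (Suc k)) =
        (\<Sum>k\<le>Suc n. to_fract (case k of 0 \<Rightarrow> 0 | Suc j \<Rightarrow> c j) * ?f k)"
      by (subst sum.atMost_Suc_shift) simp
    finally show ?thesis
      by (simp only: d_def to_fract_add sum.distrib [symmetric] distrib_right)
  qed
  moreover have "d k = 0" if "k > Suc n" for k
    using that by (auto simp: d_def c0 split: nat.splits)
  ultimately have "is_SFbar_row (Suc n) (\<lambda>k. to_fract (d k))"
    by (simp add: is_SFbar_row_def del: sum.atMost_Suc)
  thus ?case by blast
qed

lemma degree_prod_monic_linear:
  fixes a :: "nat \<Rightarrow> 'a :: idom"
  shows "degree (\<Prod>i<k. [:- a i, 1:]) = k" and "lead_coeff (\<Prod>i<k. [:- a i, 1:]) = 1"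
proof -
  show "degree (\<Prod>i<k. [:- a i, 1:]) = k"
    by (subst degree_prod_eq_sum_degree) auto
  show "lead_coeff (\<Prod>i<k. [:- a i, 1:]) = 1"
    by (simp add: lead_coeff_prod)
qed

lemma sum_monic_linear_eq_0:
  fixes a e :: "nat \<Rightarrow> 'a :: idom"
  assumes "(\<Sum>k\<le>n. smult (e k) (\<Prod>i<k. [:- a i, 1:])) = 0" and "k \<le> n"
  shows "e k = 0"
  using assms
proof (induction n)
  case 0
  thus ?case by simp
next
  case (Suc n)
  let ?B = "\<lambda>k. \<Prod>i<k. [:- a i, 1:]"
  have "coeff (?B k) (Suc n) = 0" if "k \<le> n" for k
    using that degree_prod_monic_linear(1) [of a k] by (intro coeff_eq_0) simp
  moreover have "coeff (?B (Suc n)) (Suc n) = 1"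
    using degree_prod_monic_linear [of a "Suc n"] by metis
  ultimately have "coeff (\<Sum>k\<le>Suc n. smult (e k) (?B k)) (Suc n) = e (Suc n)"
    by (simp add: coeff_sum del: prod.lessThan_Suc)
  hence e: "e (Suc n) = 0" using Suc.prems(1) by (metis coeff_0)
  show ?case
  proof (cases "k = Suc n")
    case False
    thus ?thesis using Suc e by simp
  qed (use e in simp)
qed

lemma SFbar_row_unique:
  assumes "is_SFbar_row n c" and "is_SFbar_row n d"
  shows "c = d"
proof
  fix k
  define P where
    "P = (\<Sum>k\<le>n. smult (c k - d k) (\<Prod>i<k. [:- qint (int (fib i)), 1:]))"
  have "poly P (qint (int m)) = 0" if "m > 0" for m
  proof -
    have "poly P (qint (int m)) = (\<Sum>k\<le>n. (c k - d k) * qfib_falling (int m) k)"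
      by (simp add: P_def poly_sum poly_prod qfib_falling_def)
    also have "\<dots> = qint (int m) ^ n - qint (int m) ^ n"
      using assms that by (simp add: is_SFbar_row_def sum_subtractf left_diff_distrib)
    finally show ?thesis by simp
  qed
  hence "(\<lambda>m. qint (int m)) ` {0<..} \<subseteq> {x. poly P x = 0}" by auto
  moreover have "infinite ((\<lambda>m. qint (int m)) ` {0<..})"
    using inj_qint_of_nat by (auto simp: finite_image_iff inj_on_subset infinite_Ioi)
  ultimately have "P = 0" using poly_roots_finite finite_subset by blast
  hence "c k - d k = 0" if "k \<le> n"
    using sum_monic_linear_eq_0 [of "\<lambda>k. c k - d k" _ n k] that unfolding P_def by simp
  thus "c k = d k" using assms by (cases "k \<le> n") (auto simp: is_SFbar_row_def)
qed

lemma ex1_SFbar_row: "\<exists>!c. is_SFbar_row n c"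
  using ex_polynomial_SFbar_row SFbar_row_unique by blast

lemma SFbar_row: "is_SFbar_row n (SFbar n)"
  unfolding SFbar_def by (rule theI' [OF ex1_SFbar_row])

lemma SFbar_polynomial: "\<exists>!p. SFbar n k = to_fract p"
proof -
  obtain c where "is_SFbar_row n (\<lambda>k. to_fract (c k))" using ex_polynomial_SFbar_row by blast
  hence "SFbar n = (\<lambda>k. to_fract (c k))" using SFbar_row SFbar_row_unique by blast
  thus ?thesis by auto
qed

end

theory Submission
  imports Defs
begin

text \<open>
  Newton interpolation at the nodes \<open>[F\<^sub>0]\<^sub>q, [F\<^sub>1]\<^sub>q, \<dots>\<close> gives
  \<open>SF(n,k) = h\<^bsub>n-k\<^esub>([F\<^sub>0]\<^sub>q, \<dots>, [F\<^sub>k]\<^sub>q)\<close>, where \<open>h\<^sub>j\<close> is the complete homogeneous symmetric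
  polynomial, and \<open>[F\<^sub>0]\<^sub>q = 0\<close> can be dropped. In \<open>k\<close> variables,
  \<open>h\<^sub>j(1 + q b) = \<Sum>\<^sub>i (j+k-1 choose j-i) q\<^sup>i h\<^sub>i(b)\<close>; with \<open>[m+1]\<^sub>q = 1 + q [m]\<^sub>q\<close> this makes
  \<open>(n-1 choose k-1+i)\<close> appear in the coefficient of \<open>q\<^sup>s\<close>, multiplied by the coefficient of
  \<open>q\<^bsup>s-i\<^esup>\<close> in \<open>h\<^sub>i([F\<^sub>1-1]\<^sub>q, \<dots>, [F\<^sub>k-1]\<^sub>q)\<close>.
  The first two of these variables vanish and the others are again \<open>1\<close> plus a multiple of \<open>q\<close>,
  so the same step evaluates the second factor. For \<open>s \<le> 4\<close> only \<open>F\<^sub>0, \<dots>, F\<^sub>4\<close> and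
  \<open>F\<^sub>k \<ge> 5\<close> for \<open>k \<ge> 5\<close> matter.
\<close>

text \<open>\<open>complete_homog a k j\<close> is \<open>h\<^sub>j(a\<^sub>0, \<dots>, a\<^bsub>k-1\<^esub>)\<close>.\<close>

fun complete_homog :: "(nat \<Rightarrow> 'a :: comm_semiring_1) \<Rightarrow> nat \<Rightarrow> nat \<Rightarrow> 'a" where
  "complete_homog a k 0 = 1"
| "complete_homog a 0 (Suc j) = 0"
| "complete_homog a (Suc k) (Suc j) = complete_homog a k (Suc j) + a k * complete_homog a (Suc k) j"

lemma complete_homog_degree_1: "complete_homog a k (Suc 0) = (\<Sum>i<k. a i)"
  by (induction k) simp_all

lemma complete_homog_one_variable: "complete_homog a (Suc 0) j = a 0 ^ j"
  by (induction j) simp_all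

lemma complete_homog_drop_zero:
  assumes "a 0 = 0"
  shows "complete_homog a (Suc k) j = complete_homog (\<lambda>i. a (Suc i)) k j"
  by (induction "\<lambda>i. a (Suc i)" k j rule: complete_homog.induct)
     (simp_all add: assms complete_homog_one_variable)

lemma complete_homog_scale:
  "complete_homog (\<lambda>i. c * a i) k j = c ^ j * complete_homog a k j"
  by (induction a k j rule: complete_homog.induct) (simp_all add: algebra_simps)

lemma complete_homog_shift:
  "complete_homog (\<lambda>i. c + a i) k j =
    (\<Sum>i\<le>j. of_nat (j + k - 1 choose (j - i)) * c ^ (j - i) * complete_homog a k i)"
proof (induction a k j rule: complete_homog.induct)
  case (1 a k)
  show ?case by simp
next
  case (2 a j)
  have "complete_homog a 0 i = 0" if "i > 0" for i
    using that by (cases i) simp_all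
  thus ?case by (simp add: sum.atMost_shift binomial_eq_0)
next
  case (3 a k j)
  let ?b = "\<lambda>i. of_nat (j + k choose i) * c ^ i"
  let ?h = "complete_homog a" and ?h' = "complete_homog (\<lambda>i. c + a i)"
  let ?S = "\<Sum>i\<le>j. ?b (j - i) * ?h (Suc k) i"
  have "(\<Sum>i\<le>Suc j. of_nat (Suc j + k choose (Suc j - i)) * c ^ (Suc j - i) * ?h (Suc k) i) =
      c * ?S + (\<Sum>i\<le>Suc j. ?b (Suc j - i) * ?h (Suc k) i)"
    by (simp add: Suc_diff_le sum_distrib_left sum.distrib algebra_simps)
  also have "(\<Sum>i\<le>Suc j. ?b (Suc j - i) * ?h (Suc k) i) =
      (\<Sum>i\<le>Suc j. ?b (Suc j - i) * ?h k i) + a k * ?S"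
    unfolding sum.atMost_Suc_shift by (simp add: sum_distrib_left sum.distrib algebra_simps)
  also have "c * ?S + \<dots> = ?h' k (Suc j) + (c + a k) * ?h' (Suc k) j"
    using 3 by (simp add: algebra_simps)
  finally show ?case by simp
qed

lemma power_eq_sum_complete_homog:
  fixes x :: "'a :: comm_ring_1"
  shows "x ^ n = (\<Sum>k\<le>n. complete_homog a (Suc k) (n - k) * (\<Prod>i<k. x - a i))"
proof (induction n)
  case 0
  show ?case by simp
next
  case (Suc n)
  let ?P = "\<lambda>k. \<Prod>i<k. x - a i" and ?h = "complete_homog a"
  have "x ^ Suc n = (\<Sum>k\<le>n. ?h (Suc k) (n - k) * (x * ?P k))"
    by (simp add: Suc sum_distrib_left mult_ac)
  also have "\<dots> = (\<Sum>k\<le>n. ?h (Suc k) (n - k) * ?P (Suc k)) +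
      (\<Sum>k\<le>n. a k * ?h (Suc k) (n - k) * ?P k)"
    by (simp add: algebra_simps flip: sum.distrib)
  also have "(\<Sum>k\<le>n. ?h (Suc k) (n - k) * ?P (Suc k)) = (\<Sum>k\<le>Suc n. ?h k (Suc n - k) * ?P k)"
    unfolding sum.atMost_Suc_shift by simp
  also have "\<dots> = (\<Sum>k\<le>n. ?h k (Suc (n - k)) * ?P k) + ?P (Suc n)"
    by (simp add: Suc_diff_le)
  also have "\<dots> + (\<Sum>k\<le>n. a k * ?h (Suc k) (n - k) * ?P k) =
      (\<Sum>k\<le>Suc n. ?h (Suc k) (Suc n - k) * ?P k)"
    by (simp add: Suc_diff_le sum.distrib algebra_simps)
  finally show ?case .
qed

lemma choose_2_mult_eq_choose_3:
  "int ((i + 4 choose 2) * (i + 1)) = 2 * int (i + 4 choose 3) + int (i + 3 choose 3) - int i - 3"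
proof (induction i)
  case 0
  show ?case by (simp add: numeral_eq_Suc)
next
  case (Suc i)
  have "int i * int i = 2 * int (i choose 2) + int i"
    by (induction i) (simp_all add: numeral_eq_Suc algebra_simps)
  thus ?case
    using Suc by (simp add: numeral_eq_Suc algebra_simps)
qed

definition q_number :: "nat \<Rightarrow> 'a :: comm_semiring_1 poly" where
  "q_number m = (\<Sum>i<m. monom 1 i)"

lemma q_number_0 [simp]: "q_number 0 = 0"
  by (simp add: q_number_def)

lemma q_number_1 [simp]: "q_number (Suc 0) = 1"
  by (simp add: q_number_def)

lemma coeff_q_number: "coeff (q_number m) s = of_bool (s < m)"
  by (simp add: q_number_def coeff_sum)

lemma q_number_Suc: "q_number (Suc m) = 1 + monom 1 1 * q_number m"
  by (simp add: q_number_def sum.lessThan_Suc_shift sum_distrib_left mult_monom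
      del: sum.lessThan_Suc)

abbreviation q_complete_homog :: "(nat \<Rightarrow> nat) \<Rightarrow> nat \<Rightarrow> nat \<Rightarrow> 'a :: comm_semiring_1 poly" where
  "q_complete_homog f \<equiv> complete_homog (\<lambda>i. q_number (f i))"

lemma coeff_q_complete_homog_degree_1:
  assumes "mono f" and "\<And>i. i < l \<Longrightarrow> f i \<le> s" and "s < f l"
  shows "coeff (q_complete_homog f k (Suc 0)) s = of_nat (k - l)"
proof -
  have "s < f i \<longleftrightarrow> l \<le> i" for i
    using assms(2) [of i] assms(3) monoD [OF assms(1), of l i] by (cases "l \<le> i") auto
  hence "{..<k} \<inter> {i. s < f i} = {l..<k}"
    by (simp add: set_eq_iff conj_commute)
  thus ?thesis
    by (simp add: complete_homog_degree_1 coeff_sum coeff_q_number sum_of_bool_eq)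
qed

lemma coeff_q_complete_homog_Suc:
  "coeff (q_complete_homog (\<lambda>i. Suc (f i)) (Suc k) j :: 'a :: comm_semiring_1 poly) s =
    (\<Sum>i\<le>s. of_nat (j + k choose (k + i)) * coeff (q_complete_homog f (Suc k) i) (s - i))"
proof -
  let ?h = "q_complete_homog f (Suc k) :: nat \<Rightarrow> 'a poly"
  let ?h' = "q_complete_homog (\<lambda>i. Suc (f i)) (Suc k) :: nat \<Rightarrow> 'a poly"
  have "?h' j = (\<Sum>i\<le>j. smult (of_nat (j + k choose (j - i))) (monom 1 i * ?h i))"
    by (simp add: q_number_Suc complete_homog_shift complete_homog_scale monom_power of_nat_poly)
  hence "coeff (?h' j) s =
      (\<Sum>i\<le>j. of_nat (j + k choose (j - i)) * (if s < i then 0 else coeff (?h i) (s - i)))"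
    by (simp add: coeff_sum coeff_monom_mult cong: if_cong)
  also have "\<dots> = (\<Sum>i\<le>s. of_nat (j + k choose (k + i)) * coeff (?h i) (s - i))"
  proof (intro sum.mono_neutral_cong)
    fix i assume "i \<in> {..j} \<inter> {..s}"
    moreover from this have "j + k choose (j - i) = (j + k choose (k + i))"
      by (simp add: binomial_symmetric [of "j - i" "j + k"] add.commute)
    ultimately show "of_nat (j + k choose (j - i)) * (if s < i then 0 else coeff (?h i) (s - i)) =
        of_nat (j + k choose (k + i)) * coeff (?h i) (s - i)"
      by simp
  qed (auto simp: binomial_eq_0)
  finally show ?thesis .
qed

lemma qint_eq_q_number: "qint (int m) = to_fract (q_number m)"
  by (simp add: qint_of_nat q_number_def monom_altdef)

lemma to_fract_complete_homog:
  "to_fract (complete_homog a k j) = complete_homog (\<lambda>i. to_fract (a i)) k j"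
  by (induction a k j rule: complete_homog.induct) simp_all

lemma SFbar_eq_complete_homog:
  assumes "k \<le> n"
  shows "SFbar n k = to_fract (q_complete_homog fib (Suc k) (n - k))"
proof -
  let ?c = "\<lambda>k. complete_homog (\<lambda>i. qint (int (fib i))) (Suc k) (n - k)"
  have "is_SFbar_row n (\<lambda>k. if k \<le> n then ?c k else 0)"
    using power_eq_sum_complete_homog [of _ n "\<lambda>i. qint (int (fib i))"]
    by (simp add: is_SFbar_row_def qfib_falling_def)
  hence "SFbar n k = ?c k"
    using SFbar_row_unique [OF SFbar_row] assms by simp
  thus ?thesis by (simp only: qint_eq_q_number to_fract_complete_homog)
qed

lemma SFbar_eq_0: "n < k \<Longrightarrow> SFbar n k = 0"
  using SFbar_row by (simp add: is_SFbar_row_def)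

definition fib_pred_homog :: "nat \<Rightarrow> nat \<Rightarrow> int poly" where
  "fib_pred_homog = q_complete_homog (\<lambda>i. fib (Suc i) - 1)"

lemma qcoeff_SFbar:
  assumes "n > 0"
  shows "qcoeff (SFbar n (Suc k)) s =
    (\<Sum>i\<le>s. int (n - 1 choose (k + i)) * coeff (fib_pred_homog (Suc k) i) (s - i))"
proof (cases "k < n")
  case True
  have "Suc (fib (Suc i) - 1) = fib (Suc i)" for i
    using fib_neq_0_nat [of "Suc i"] by simp
  hence "SFbar n (Suc k) =
      to_fract (q_complete_homog (\<lambda>i. Suc (fib (Suc i) - 1)) (Suc k) (n - Suc k))"
    using SFbar_eq_complete_homog [of "Suc k" n]
      complete_homog_drop_zero [of "\<lambda>i. q_number (fib i)"] True
    by simp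
  thus ?thesis
    using True
    by (simp only: qcoeff_to_fract coeff_q_complete_homog_Suc fib_pred_homog_def) simp
next
  case False
  thus ?thesis
    using assms qcoeff_to_fract [of 0] by (simp add: SFbar_eq_0 binomial_eq_0)
qed

lemma fib_pred_homog_degree_0 [simp]: "fib_pred_homog k 0 = 1"
  by (simp add: fib_pred_homog_def)

lemma fib_pred_homog_drop_zeros:
  "fib_pred_homog (k + 2) j = q_complete_homog (\<lambda>i. fib (i + 3) - 1) k j"
  by (simp add: fib_pred_homog_def complete_homog_drop_zero numeral_eq_Suc)

lemma coeff_fib_pred_homog:
  "coeff (fib_pred_homog (k + 3) j) s =
    (\<Sum>i\<le>s. int (j + k choose (k + i)) *
      coeff (q_complete_homog (\<lambda>i. fib (i + 4) - 2) k i) (s - i))"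
proof -
  have "fib (i + 3) - 1 = Suc (fib (i + 3) - 2)" for i
    using fib_mono [of 3 "i + 3"] by (simp add: numeral_eq_Suc)
  hence "coeff (fib_pred_homog (k + 3) j) s =
      coeff (q_complete_homog (\<lambda>i. Suc (fib (i + 3) - 2)) (Suc k) j) s"
    using fib_pred_homog_drop_zeros [of "Suc k" j] by (simp add: numeral_eq_Suc)
  thus ?thesis
    by (simp add: coeff_q_complete_homog_Suc complete_homog_drop_zero numeral_eq_Suc)
qed

lemma coeff_fib_pred_homog_degree_1:
  "coeff (fib_pred_homog k (Suc 0)) 0 = int (k - 2)"
  "coeff (fib_pred_homog k (Suc 0)) (Suc 0) = int (k - 3)"
  "coeff (fib_pred_homog k (Suc 0)) 2 = int (k - 4)"
  "coeff (fib_pred_homog k (Suc 0)) 3 = int (k - 4)"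
proof -
  have "mono (\<lambda>i. fib (Suc i) - 1)"
    by (intro monoI diff_le_mono fib_mono) simp
  note degree_1 = coeff_q_complete_homog_degree_1 [OF this]
  show "coeff (fib_pred_homog k (Suc 0)) 0 = int (k - 2)"
    unfolding fib_pred_homog_def by (subst degree_1 [of 2]) (auto simp: numeral_eq_Suc less_Suc_eq)
  show "coeff (fib_pred_homog k (Suc 0)) (Suc 0) = int (k - 3)"
    unfolding fib_pred_homog_def by (subst degree_1 [of 3]) (auto simp: numeral_eq_Suc less_Suc_eq)
  show "coeff (fib_pred_homog k (Suc 0)) 2 = int (k - 4)"
    unfolding fib_pred_homog_def by (subst degree_1 [of 4]) (auto simp: numeral_eq_Suc less_Suc_eq)
  show "coeff (fib_pred_homog k (Suc 0)) 3 = int (k - 4)"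
    unfolding fib_pred_homog_def by (subst degree_1 [of 4]) (auto simp: numeral_eq_Suc less_Suc_eq)
qed

lemma coeff_0_fib_pred_homog: "coeff (fib_pred_homog (k + 3) j) 0 = int (j + k choose k)"
  by (simp add: coeff_fib_pred_homog)

lemma coeff_1_fib_pred_homog:
  "coeff (fib_pred_homog (k + 3) j) 1 = int (j + k choose (k + 1)) * int k"
proof -
  have "fib (i + 4) - 2 > 0" for i
    using fib_mono [of 4 "i + 4"] by (simp add: numeral_eq_Suc)
  thus ?thesis
    by (simp add: coeff_fib_pred_homog complete_homog_degree_1 coeff_sum coeff_q_number)
qed

lemma coeff_2_fib_pred_homog:
  "coeff (fib_pred_homog (k + 4) j) 2 =
    int (j + k + 1 choose (k + 2)) * int k + int (j + k + 1 choose (k + 3)) * int (k + 2 choose 2)"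
proof -
  let ?h = "q_complete_homog (\<lambda>i. fib (i + 4) - 2) (k + 1) :: nat \<Rightarrow> int poly"
  have "mono (\<lambda>i. fib (i + 4) - 2)"
    by (intro monoI diff_le_mono fib_mono) simp
  hence "coeff (?h 1) 1 = int k"
    using coeff_q_complete_homog_degree_1 [of "\<lambda>i. fib (i + 4) - 2" 1 1 "k + 1"]
    by (simp add: numeral_eq_Suc)
  moreover have "coeff (?h 2) 0 = int (k + 2 choose 2)"
  proof -
    have "fib (i + 4) - 2 = Suc (fib (i + 4) - 3)" for i
      using fib_mono [of 4 "i + 4"] by (simp add: numeral_eq_Suc)
    hence "coeff (?h 2) 0 = int (k + 2 choose k)"
      by (simp only: Suc_eq_plus1 [symmetric] coeff_q_complete_homog_Suc) simp
    thus ?thesis by (simp add: binomial_symmetric [of 2])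
  qed
  ultimately show ?thesis
    using coeff_fib_pred_homog [of "k + 1" j 2] by (simp add: numeral_eq_Suc)
qed

lemma qcoeff_0_SFbar:
  assumes "n > 0" and "k \<ge> 1"
  shows "qcoeff (SFbar n k) 0 = int (n - 1 choose (k - 1))"
  using qcoeff_SFbar [of n "k - 1" 0] assms by simp

lemma qcoeff_1_SFbar:
  assumes "n > 0" and "k \<ge> 2"
  shows "qcoeff (SFbar n k) 1 = (int k - 2) * int (n - 1 choose k)"
  using qcoeff_SFbar [of n "k - 1" 1] assms
  by (simp add: coeff_fib_pred_homog_degree_1)

lemma qcoeff_SFbar_column_3:
  assumes "n > 0"
  shows "qcoeff (SFbar n 3) s = int (n - 1 choose (s + 2))"
proof -
  have "fib_pred_homog 3 i = 1" for i
    using fib_pred_homog_drop_zeros [of "Suc 0" i]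
    by (simp add: complete_homog_one_variable numeral_eq_Suc)
  hence "qcoeff (SFbar n 3) s = (\<Sum>i\<le>s. int (n - 1 choose (2 + i)) * of_bool (s - i = 0))"
    using qcoeff_SFbar [OF assms, of 2 s] by simp
  also have "\<dots> = (\<Sum>i\<in>{s}. int (n - 1 choose (2 + i)))"
    by (intro sum.mono_neutral_cong_right) auto
  finally show ?thesis by (simp add: add.commute)
qed

lemma qcoeff_2_SFbar:
  assumes "n > 0" and "k \<ge> 3"
  shows "qcoeff (SFbar n k) 2 =
    (int k - 3) * int (n - 1 choose k) + int (k - 1 choose 2) * int (n - 1 choose (k + 1))"
proof -
  obtain i where "k = i + 3"
    using \<open>k \<ge> 3\<close> by (metis le_add_diff_inverse2)
  hence "coeff (fib_pred_homog k 2) 0 = int (k - 1 choose 2)"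
    using coeff_0_fib_pred_homog [of i 2] binomial_symmetric [of 2 "i + 2"] by simp
  thus ?thesis
    using qcoeff_SFbar [of n "k - 1" 2] assms
    by (simp add: atMost_nat_numeral coeff_fib_pred_homog_degree_1)
qed

lemma qcoeff_3_SFbar:
  assumes "n > 0" and "k \<ge> 4"
  shows "qcoeff (SFbar n k) 3 =
    (int k - 4) * int (n - 1 choose k)
    + (int (k - 1 choose 2) + int (k - 2 choose 2) - 1) * int (n - 1 choose (k + 1))
    + int (k choose 3) * int (n - 1 choose (k + 2))"
proof -
  obtain i where i: "k = i + 4"
    using \<open>k \<ge> 4\<close> by (metis le_add_diff_inverse2)
  have "int ((i + 3) * (i + 1)) = int (k - 1 choose 2) + int (k - 2 choose 2) - 1"
    unfolding i by (induction i) (simp_all add: numeral_eq_Suc algebra_simps)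
  hence "coeff (fib_pred_homog k 2) 1 = int (k - 1 choose 2) + int (k - 2 choose 2) - 1"
    using coeff_1_fib_pred_homog [of "i + 1" 2] binomial_symmetric [of 1 "i + 3"] i
    by (simp add: algebra_simps)
  moreover have "coeff (fib_pred_homog k 3) 0 = int (k choose 3)"
    using coeff_0_fib_pred_homog [of "i + 1" 3] binomial_symmetric [of 3 "i + 4"] i
    by (simp add: add.commute)
  ultimately show ?thesis
    using qcoeff_SFbar [of n "k - 1" 3] assms
    by (simp add: atMost_nat_numeral coeff_fib_pred_homog_degree_1)
qed

lemma qcoeff_4_SFbar:
  assumes "n > 0" and "k \<ge> 4"
  shows "qcoeff (SFbar n k) 4 =
    (int k - 4) * int (n - 1 choose k)
    + (int (k - 1 choose 2) + int (k - 2 choose 2) + int (k - 3 choose 2) - 3)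
        * int (n - 1 choose (k + 1))
    + (2 * int (k choose 3) + int (k - 1 choose 3) - int k + 1) * int (n - 1 choose (k + 2))
    + int (k + 1 choose 4) * int (n - 1 choose (k + 3))"
proof -
  obtain i where i: "k = i + 4"
    using \<open>k \<ge> 4\<close> by (metis le_add_diff_inverse2)
  have "int ((i + 3) * i + (i + 2 choose 2)) =
      int (k - 1 choose 2) + int (k - 2 choose 2) + int (k - 3 choose 2) - 3"
    unfolding i by (induction i) (simp_all add: numeral_eq_Suc algebra_simps)
  hence "coeff (fib_pred_homog k 2) 2 =
      int (k - 1 choose 2) + int (k - 2 choose 2) + int (k - 3 choose 2) - 3"
    using coeff_2_fib_pred_homog [of i 2] binomial_symmetric [of 1 "i + 3"] i
    by (simp add: numeral_3_eq_3 algebra_simps)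
  moreover have "coeff (fib_pred_homog k 3) 1 =
      2 * int (k choose 3) + int (k - 1 choose 3) - int k + 1"
    using coeff_1_fib_pred_homog [of "i + 1" 3] binomial_symmetric [of 2 "i + 4"]
      choose_2_mult_eq_choose_3 [of i] i
    by (simp add: algebra_simps)
  moreover have "coeff (fib_pred_homog k 4) 0 = int (k + 1 choose 4)"
    using coeff_0_fib_pred_homog [of "i + 1" 4] binomial_symmetric [of 4 "i + 5"] i
    by (simp add: add.commute)
  ultimately show ?thesis
    using qcoeff_SFbar [of n "k - 1" 4] assms
    by (simp add: atMost_nat_numeral coeff_fib_pred_homog_degree_1 add.commute)
qed

theorem theorem12:
  shows
    "(\<forall>n k :: nat. n \<ge> k \<and> k \<ge> 1 \<longrightarrow>
        qcoeff (SFbar n k) 0 = int ((n - 1) choose (k - 1)))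
   \<and> (\<forall>n k :: nat. n > k \<and> k \<ge> 2 \<longrightarrow>
        qcoeff (SFbar n k) 1 = (int k - 2) * int ((n - 1) choose k))
   \<and> (\<forall>s n :: nat. n \<ge> s \<longrightarrow>
        qcoeff (SFbar n 3) s = int ((n - 1) choose (s + 2)))
   \<and> (\<forall>n k :: nat. n \<ge> k \<and> k \<ge> 3 \<longrightarrow>
        qcoeff (SFbar n k) 2 =
          (int k - 3) * int ((n - 1) choose k)
          + int ((k - 1) choose 2) * int ((n - 1) choose (k + 1)))
   \<and> (\<forall>n k :: nat. n \<ge> k \<and> k \<ge> 4 \<longrightarrow>
        qcoeff (SFbar n k) 3 =
          (int k - 4) * int ((n - 1) choose k)
          + (int ((k - 1) choose 2) + int ((k - 2) choose 2) - 1) * int ((n - 1) choose (k + 1))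
          + int (k choose 3) * int ((n - 1) choose (k + 2)))
   \<and> (\<forall>n k :: nat. n \<ge> k \<and> k \<ge> 4 \<longrightarrow>
        qcoeff (SFbar n k) 4 =
          (int k - 4) * int ((n - 1) choose k)
          + (int ((k - 1) choose 2) + int ((k - 2) choose 2) + int ((k - 3) choose 2) - 3)
              * int ((n - 1) choose (k + 1))
          + (2 * int (k choose 3) + int ((k - 1) choose 3) - int k + 1)
              * int ((n - 1) choose (k + 2))
          + int ((k + 1) choose 4) * int ((n - 1) choose (k + 3)))"
proof (intro conjI allI impI)
  show "qcoeff (SFbar n 3) s = int (n - 1 choose (s + 2))" if "n \<ge> s" for s n
    using that qcoeff_SFbar_column_3 [of n s] qcoeff_to_fract [of 0]
    by (cases "n = 0") (simp_all add: SFbar_eq_0)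
qed (use qcoeff_0_SFbar qcoeff_1_SFbar qcoeff_2_SFbar qcoeff_3_SFbar qcoeff_4_SFbar in simp_all)

end
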